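(* Let $m,n$ be positive integers with $m \leq n = 2^r$ for some positive integer $r$, and let $\mathbf{v}_1,\ldots,\mathbf{v}_n \in \mathbb{C}^m$ be vectors of equal length forming a Parseval frame for $\mathbb{C}^m$. Let $F = [\mathbf{f}_1,\ldots,\mathbf{f}_n] = Y_r/\sqrt{n} \in \mathbb{C}^{n\times n}$ be the normalized Walsh matrix of order $r$, with columns $\mathbf{f}_j$. Then there exist vectors $\mathbf{r}_1,\ldots,\mathbf{r}_n \in \mathbb{C}^{n-m}$ and a unitary matrix $P \in \mathbb{C}^{n\times n}$ such that the vectors $$\mathbf{g}_j = \begin{bmatrix}\mathbf{v}_j \\ \mathbf{r}_j\end{bmatrix}\in\mathbb{C}^n,\qquad j=1,\ldots,n,$$ form an orthonormal basis of $\mathbb{C}^n$, $P\mathbf{g}_j = \mathbf{f}_j$ for each $j=1,\ldots,n$, and for all $\mathbf{x}\in\mathbb{C}^m$ $$\begin{bmatrix}\mathbf{x}\\ \mathbf{0}\end{bmatrix} = \sum_{j=1}^n (\mathbf{v}_j^*\mathbf{x})\,\mathbf{g}_j \quad\text{and}\quad P\begin{bmatrix}\mathbf{x}\\ \mathbf{0}\end{bmatrix} = \sum_{j=1}^n (\mathbf{v}_j^*\mathbf{x})\,\mathbf{f}_j .$$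
   Context: The Walsh matrices (natural ordering, Sylvester construction) are defined recursively by $Y_0 = [1]$ and $Y_r = \begin{bmatrix} Y_{r-1} & Y_{r-1} \\ Y_{r-1} & -Y_{r-1}\end{bmatrix}$ for $r \geq 1$, so $Y_r$ is a $2^r \times 2^r$ matrix with entries $\pm 1$. A finite family $\mathbf{v}_1,\ldots,\mathbf{v}_n \in \mathbb{C}^m$ is a Parseval frame for $\mathbb{C}^m$ if $\sum_{j=1}^n |\mathbf{v}_j^*\mathbf{x}|^2 = 1$ for all $\mathbf{x}\in\mathbb{C}^m$ with $\|\mathbf{x}\|=1$; equivalently $VV^* = I_m$ where $V=[\mathbf{v}_1,\ldots,\mathbf{v}_n]$. Here $^*$ denotes conjugate transpose. When $m=n$ the vectors $\mathbf{r}_j$ are empty and $\mathbf{g}_j=\mathbf{v}_j$. *)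

theory Defs
  imports "Jordan_Normal_Form.Schur_Decomposition" "Jordan_Normal_Form.VS_Connect"
begin

primrec walsh :: "nat \<Rightarrow> complex mat" where
  "walsh 0 = mat 1 1 (\<lambda>_. 1)"
| "walsh (Suc r) = four_block_mat (walsh r) (walsh r) (walsh r) (- walsh r)"

lemma walsh_carrier: "walsh r \<in> carrier_mat (2 ^ r) (2 ^ r)"
  by (induction r) (auto simp: mult_2)

definition cvec_norm :: "complex vec \<Rightarrow> real" where
  "cvec_norm x = sqrt (\<Sum>i<dim_vec x. (cmod (x $ i))\<^sup>2)"

text \<open>Families of \<open>n\<close> vectors are functions on \<open>nat\<close> of which only the values at
  the indices \<open>0, \<dots>, n - 1\<close> matter. The product \<open>x \<bullet>c v\<close> conjugates its second
  argument, so it is the number \<open>v\<^sup>* x\<close>.\<close>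

definition parseval_frame :: "nat \<Rightarrow> nat \<Rightarrow> (nat \<Rightarrow> complex vec) \<Rightarrow> bool" where
  "parseval_frame m n v \<longleftrightarrow>
     (\<forall>j<n. v j \<in> carrier_vec m) \<and>
     (\<forall>x\<in>carrier_vec m. cvec_norm x = 1 \<longrightarrow> (\<Sum>j<n. (cmod (x \<bullet>c v j))\<^sup>2) = 1)"

definition orthonormal_basis :: "nat \<Rightarrow> (nat \<Rightarrow> complex vec) \<Rightarrow> bool" where
  "orthonormal_basis n g \<longleftrightarrow>
     (\<forall>j<n. g j \<in> carrier_vec n) \<and>
     (\<forall>i<n. \<forall>j<n. g i \<bullet>c g j = (if i = j then 1 else 0)) \<and>
     vectorspace.basis class_ring (module_vec TYPE(complex) n) (g ` {..<n})"

definition unitary_mat :: "nat \<Rightarrow> complex mat \<Rightarrow> bool" where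
  "unitary_mat n P \<longleftrightarrow>
     P \<in> carrier_mat n n \<and> mat_adjoint P * P = 1\<^sub>m n \<and> P * mat_adjoint P = 1\<^sub>m n"

end

theory Submission
  imports Defs
begin

text \<open>
  The Parseval identity says that the \<open>m \<times> n\<close> matrix \<open>V\<close> with columns \<open>v\<^sub>j\<close> satisfies
  \<open>V V\<^sup>* = 1\<close>, that is, that its \<open>m\<close> rows are orthonormal in \<open>\<complex>\<^sup>n\<close>
  (\<open>parseval_frame_rows_orthonormal\<close>). Orthonormal vectors extend to \<open>n\<close> orthonormal vectors
  (\<open>orthonormal_extend\<close>); taken as rows, these form a unitary matrix \<open>G\<close> whose first \<open>m\<close> rows
  are those of \<open>V\<close>. The columns \<open>g\<^sub>j\<close> of \<open>G\<close> thus extend the \<open>v\<^sub>j\<close>, and they are an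
  orthonormal basis because a square matrix with orthonormal rows also has orthonormal columns.

  The matrix \<open>F\<close> is unitary since \<open>Y\<^sub>r\<close> is Hermitian with \<open>Y\<^sub>r\<^sup>2 = 2\<^sup>r\<close>, so \<open>P = F G\<^sup>*\<close> is
  unitary and maps \<open>g\<^sub>j\<close> to \<open>f\<^sub>j\<close>. For \<open>y = (x, 0)\<close> the \<open>j\<close>-th coordinate of \<open>G\<^sup>* y\<close> is
  \<open>v\<^sub>j\<^sup>* x\<close>, so the two expansions are the identities \<open>y = G (G\<^sup>* y)\<close> and \<open>P y = F (G\<^sup>* y)\<close>
  written out by columns.
\<close>

section \<open>Adjoints and unitary matrices\<close>

lemma mat_adjoint_dims [simp]:
  "dim_row (mat_adjoint A) = dim_col A" "dim_col (mat_adjoint A) = dim_row A"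
  by (simp_all add: mat_adjoint_def)

lemma mat_adjoint_carrier:
  "A \<in> carrier_mat p q \<Longrightarrow> mat_adjoint A \<in> carrier_mat q p"
  by (intro carrier_matI) (auto dest: carrier_matD)

lemma mat_adjoint_index [simp]:
  "i < dim_col A \<Longrightarrow> j < dim_row A \<Longrightarrow> mat_adjoint A $$ (i, j) = conjugate (A $$ (j, i))"
  by (simp add: mat_adjoint_def mat_of_rows_index)

lemma mat_adjoint_adjoint: "mat_adjoint (mat_adjoint A) = A"
  by (rule eq_matI) simp_all

lemma mat_adjoint_mult:
  fixes A B :: "complex mat"
  assumes A: "A \<in> carrier_mat p q" and B: "B \<in> carrier_mat q s"
  shows "mat_adjoint (A * B) = mat_adjoint B * mat_adjoint A"
  using A B by (intro eq_matI) (auto simp: scalar_prod_def mult.commute)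

lemma unitary_matI:
  assumes "A \<in> carrier_mat n n" "A * mat_adjoint A = 1\<^sub>m n"
  shows "unitary_mat n A"
  using assms mat_mult_left_right_inverse[OF assms(1) mat_adjoint_carrier[OF assms(1)] assms(2)]
  by (simp add: unitary_mat_def)

lemma unitary_mat_adjoint:
  "unitary_mat n A \<Longrightarrow> unitary_mat n (mat_adjoint A)"
  by (auto simp: unitary_mat_def mat_adjoint_adjoint intro: mat_adjoint_carrier)

lemma unitary_mat_mult:
  assumes "unitary_mat n A" "unitary_mat n B"
  shows "unitary_mat n (A * B)"
proof (rule unitary_matI)
  have A: "A \<in> carrier_mat n n" "A * mat_adjoint A = 1\<^sub>m n"
    and B: "B \<in> carrier_mat n n" "B * mat_adjoint B = 1\<^sub>m n"
    using assms by (auto simp: unitary_mat_def)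
  note A' = mat_adjoint_carrier[OF A(1)] and B' = mat_adjoint_carrier[OF B(1)]
  show "A * B \<in> carrier_mat n n" using A B by auto
  have "A * B * (mat_adjoint B * mat_adjoint A) = A * (B * mat_adjoint B * mat_adjoint A)"
    using A(1) B(1) A' B' by (simp add: assoc_mult_mat[of _ n n _ n _ n])
  also have "\<dots> = 1\<^sub>m n"
    using A(2) B(2) by (simp add: left_mult_one_mat[OF A'])
  finally show "A * B * mat_adjoint (A * B) = 1\<^sub>m n"
    by (simp add: mat_adjoint_mult[OF A(1) B(1)])
qed

lemma mult_mat_vec_eq_finsum_cols:
  fixes A :: "complex mat"
  assumes A: "A \<in> carrier_mat p n"
  shows "A *\<^sub>v vec n c = finsum_vec TYPE(complex) p (\<lambda>j. c j \<cdot>\<^sub>v col A j) {..<n}"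
proof (rule eq_vecI)
  have cl: "(\<lambda>j. c j \<cdot>\<^sub>v col A j) \<in> {..<n} \<rightarrow> carrier_vec p" using A by auto
  have fc: "finsum_vec TYPE(complex) p (\<lambda>j. c j \<cdot>\<^sub>v col A j) {..<n} \<in> carrier_vec p"
    by (rule finsum_vec_closed[OF cl])
  show "dim_vec (A *\<^sub>v vec n c)
      = dim_vec (finsum_vec TYPE(complex) p (\<lambda>j. c j \<cdot>\<^sub>v col A j) {..<n})"
    using A carrier_vecD[OF fc] by simp
  fix i assume "i < dim_vec (finsum_vec TYPE(complex) p (\<lambda>j. c j \<cdot>\<^sub>v col A j) {..<n})"
  hence i: "i < p" using carrier_vecD[OF fc] by simp
  show "(A *\<^sub>v vec n c) $ i
      = finsum_vec TYPE(complex) p (\<lambda>j. c j \<cdot>\<^sub>v col A j) {..<n} $ i"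
    unfolding index_finsum_vec[OF finite_lessThan i cl]
    using A i by (auto simp: scalar_prod_def lessThan_atLeast0 mult.commute intro!: sum.cong)
qed

lemma unitary_mat_cols_orthonormal_basis:
  assumes "unitary_mat n G"
  shows "orthonormal_basis n (col G)"
proof -
  have G: "G \<in> carrier_mat n n" and GG: "mat_adjoint G * G = 1\<^sub>m n"
    using assms by (auto simp: unitary_mat_def)
  note G' = mat_adjoint_carrier[OF G]
  have orth: "col G i \<bullet>c col G j = (if i = j then 1 else 0)" if ij: "i < n" "j < n" for i j
  proof -
    have "col G i \<bullet>c col G j = (mat_adjoint G * G) $$ (j, i)"
      using G G' ij by (auto simp: scalar_prod_def mult.commute intro!: sum.cong)
    with ij show ?thesis by (auto simp: GG)
  qed
  interpret vs: vec_space "TYPE(complex)" n .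
  have inj: "inj_on (col G) {..<n}"
  proof (rule inj_onI, rule ccontr)
    fix i j assume "i \<in> {..<n}" "j \<in> {..<n}" "col G i = col G j" "i \<noteq> j"
    with orth[of i j] orth[of i i] show False by auto
  qed
  have "det (mat_adjoint G) * det G = 1"
    using det_mult[OF G' G] by (simp add: GG)
  hence "det G \<noteq> 0" by auto
  hence li: "vs.lin_indpt (set (cols G))"
    using vs.lin_dep_cols_imp_det_0[OF G] by auto
  have img: "set (cols G) = col G ` {..<n}"
    using G by (auto simp: cols_def)
  have "vs.basis (col G ` {..<n})"
    using li[unfolded img] inj G
    by (intro vs.dim_li_is_basis) (auto simp: card_image vs.dim_is_n)
  thus ?thesis
    using G orth by (auto simp: orthonormal_basis_def)
qed

section \<open>Walsh matrices\<close>

lemma walsh_hermitian: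
  "i < 2 ^ r \<Longrightarrow> j < 2 ^ r \<Longrightarrow> cnj (walsh r $$ (j, i)) = walsh r $$ (i, j)"
proof (induction r arbitrary: i j)
  case (Suc r)
  from walsh_carrier[of r] have [simp]: "dim_row (walsh r) = 2 ^ r" "dim_col (walsh r) = 2 ^ r"
    by auto
  show ?case using Suc.prems
    by (auto simp: Suc.IH)
qed simp

lemma walsh_square: "walsh r * walsh r = 2 ^ r \<cdot>\<^sub>m 1\<^sub>m (2 ^ r)"
proof (induction r)
  case 0
  show ?case by (rule eq_matI) (auto simp: scalar_prod_def)
next
  case (Suc r)
  note Y = walsh_carrier[of r]
  have "walsh (Suc r) * walsh (Suc r) = four_block_mat
      (walsh r * walsh r + walsh r * walsh r) (walsh r * walsh r + walsh r * (- walsh r))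
      (walsh r * walsh r + (- walsh r) * walsh r)
      (walsh r * walsh r + (- walsh r) * (- walsh r))"
    using Y by (simp add: mult_four_block_mat[of _ "2 ^ r" "2 ^ r" _ "2 ^ r" _ "2 ^ r" _ _ "2 ^ r" _ "2 ^ r"])
  also have "\<dots> = 2 ^ Suc r \<cdot>\<^sub>m 1\<^sub>m (2 ^ Suc r)"
    using Y by (intro eq_matI) (auto simp: Suc.IH)
  finally show ?case .
qed

lemma normalized_walsh_unitary:
  "unitary_mat (2 ^ r) (complex_of_real (1 / sqrt (2 ^ r)) \<cdot>\<^sub>m walsh r)"
proof (rule unitary_matI)
  let ?c = "complex_of_real (1 / sqrt (2 ^ r))"
  note Y = walsh_carrier[of r]
  hence F: "?c \<cdot>\<^sub>m walsh r \<in> carrier_mat (2 ^ r) (2 ^ r)" by simp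
  then show "?c \<cdot>\<^sub>m walsh r \<in> carrier_mat (2 ^ r) (2 ^ r)" .
  have adj: "mat_adjoint (?c \<cdot>\<^sub>m walsh r) = ?c \<cdot>\<^sub>m walsh r"
  proof (rule eq_matI)
    fix i j assume "i < dim_row (?c \<cdot>\<^sub>m walsh r)" "j < dim_col (?c \<cdot>\<^sub>m walsh r)"
    hence "i < 2 ^ r" "j < 2 ^ r" using Y by auto
    thus "mat_adjoint (?c \<cdot>\<^sub>m walsh r) $$ (i, j) = (?c \<cdot>\<^sub>m walsh r) $$ (i, j)"
      using Y by (simp add: walsh_hermitian del: of_real_divide)
  qed (use Y in auto)
  have "?c * ?c = complex_of_real (1 / sqrt (2 ^ r) * (1 / sqrt (2 ^ r)))"
    by (simp only: of_real_mult)
  also have "\<dots> = 1 / 2 ^ r"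
    by (simp add: real_sqrt_mult_self)
  finally have cc: "?c * (?c * 2 ^ r) = 1"
    by (simp add: mult.assoc[symmetric] del: of_real_divide)
  have "(?c \<cdot>\<^sub>m walsh r) * (?c \<cdot>\<^sub>m walsh r) = ?c \<cdot>\<^sub>m (?c \<cdot>\<^sub>m (walsh r * walsh r))"
    using Y by (simp add: mult_smult_distrib[OF F Y] mult_smult_assoc_mat[OF Y Y] del: of_real_divide)
  also have "\<dots> = 1\<^sub>m (2 ^ r)"
    using cc by (intro eq_matI) (auto simp: walsh_square)
  finally show "(?c \<cdot>\<^sub>m walsh r) * mat_adjoint (?c \<cdot>\<^sub>m walsh r) = 1\<^sub>m (2 ^ r)"
    by (simp only: adj)
qed

section \<open>Extending orthonormal families\<close>

text \<open>Fewer than \<open>n\<close> linear equations in \<open>n\<close> unknowns have a nontrivial solution: pad the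
  coefficient matrix with zero rows to a singular square matrix.\<close>

lemma exists_nonzero_orthogonal:
  fixes w :: "nat \<Rightarrow> complex vec"
  assumes w: "\<And>i. i < k \<Longrightarrow> w i \<in> carrier_vec n" and kn: "k < n"
  shows "\<exists>u\<in>carrier_vec n. u \<noteq> 0\<^sub>v n \<and> (\<forall>i<k. w i \<bullet>c u = 0)"
proof -
  define A where "A = mat\<^sub>r n n (\<lambda>i. if i = k then 0\<^sub>v n else if i < k then w i else 0\<^sub>v n)"
  have A: "A \<in> carrier_mat n n" by (simp add: A_def)
  have rw: "row A i = (if i < k then w i else 0\<^sub>v n)" if "i < n" for i
    using that w by (auto simp: A_def)
  have "det A = 0"
    unfolding A_def by (rule det_row_0[OF kn]) (use w in auto)
  then obtain u where u: "u \<in> carrier_vec n" "u \<noteq> 0\<^sub>v n" "A *\<^sub>v u = 0\<^sub>v n"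
    using det_0_iff_vec_prod_zero[OF A] by blast
  have "w i \<bullet> u = 0" if "i < k" for i
  proof -
    have "(A *\<^sub>v u) $ i = w i \<bullet> u" using that kn A rw[of i] by simp
    thus ?thesis using u(3) that kn by simp
  qed
  \<comment> \<open>\<open>A u = 0\<close> is bilinear orthogonality, so the conjugate of \<open>u\<close> is the witness for \<open>\<bullet>c\<close>.\<close>
  thus ?thesis using u by (intro bexI[of _ "conjugate u"]) auto
qed

lemma exists_unit_orthogonal:
  fixes w :: "nat \<Rightarrow> complex vec"
  assumes w: "\<And>i. i < k \<Longrightarrow> w i \<in> carrier_vec n" and kn: "k < n"
  shows "\<exists>u\<in>carrier_vec n. u \<bullet>c u = 1 \<and> (\<forall>i<k. w i \<bullet>c u = 0)"
proof -
  obtain u where u: "u \<in> carrier_vec n" "u \<noteq> 0\<^sub>v n" "\<And>i. i < k \<Longrightarrow> w i \<bullet>c u = 0"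
    using exists_nonzero_orthogonal[of k w n] w kn by blast
  have pos: "u \<bullet>c u > 0" using u by simp
  define s where "s = Re (u \<bullet>c u)"
  have s: "u \<bullet>c u = complex_of_real s" "s > 0"
    using pos by (auto simp: s_def less_complex_def complex_eq_iff)
  define t where "t = complex_of_real (1 / sqrt s)"
  have "t * (cnj t * (u \<bullet>c u)) = complex_of_real (1 / sqrt s * (1 / sqrt s * s))"
    by (simp only: t_def s(1) of_real_mult complex_cnj_complex_of_real)
  also have "1 / sqrt s * (1 / sqrt s * s) = 1"
    using s(2) by (simp add: field_simps)
  finally have "t * (cnj t * (u \<bullet>c u)) = 1" by simp
  thus ?thesis
    using u w by (intro bexI[of _ "t \<cdot>\<^sub>v u"]) (auto simp: conjugate_smult_vec mult.left_commute)
qed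

lemma orthonormal_extend:
  fixes w :: "nat \<Rightarrow> complex vec"
  assumes "k \<le> n"
    and "\<And>i. i < k \<Longrightarrow> w i \<in> carrier_vec n"
    and "\<And>i j. i < k \<Longrightarrow> j < k \<Longrightarrow> w i \<bullet>c w j = (if i = j then 1 else 0)"
  shows "\<exists>w'. (\<forall>i<k. w' i = w i) \<and> (\<forall>i<n. w' i \<in> carrier_vec n) \<and>
    (\<forall>i<n. \<forall>j<n. w' i \<bullet>c w' j = (if i = j then 1 else 0))"
  using assms
proof (induction k arbitrary: w rule: inc_induct)
  case base
  thus ?case by (intro exI[of _ w]) auto
next
  case (step k)
  obtain u where u: "u \<in> carrier_vec n" "u \<bullet>c u = 1" "\<And>i. i < k \<Longrightarrow> w i \<bullet>c u = 0"
    using exists_unit_orthogonal[of k w n] step.prems(1) step.hyps(2) by blast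
  have u': "u \<bullet>c w i = 0" if "i < k" for i
  proof -
    have "u \<bullet>c w i = conjugate (w i \<bullet>c u)"
      using u(1) step.prems(1)[OF that] conjugate_vec_sprod_comm[of u n "w i"]
        conjugate_sprod_vec[of "w i" n "conjugate u"] by simp
    thus ?thesis using u(3)[OF that] by simp
  qed
  have "\<exists>w'. (\<forall>i<Suc k. w' i = (w(k := u)) i) \<and> (\<forall>i<n. w' i \<in> carrier_vec n) \<and>
      (\<forall>i<n. \<forall>j<n. w' i \<bullet>c w' j = (if i = j then 1 else 0))"
    by (rule step.IH) (use u u' step.prems in \<open>auto simp: less_Suc_eq\<close>)
  then obtain w' where w': "\<forall>i<Suc k. w' i = (w(k := u)) i"
    and on: "\<forall>i<n. w' i \<in> carrier_vec n"
      "\<forall>i<n. \<forall>j<n. w' i \<bullet>c w' j = (if i = j then 1 else 0)"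
    by blast
  from w' have "\<forall>i<k. w' i = w i" by simp
  with on show ?case by blast
qed

section \<open>Parseval frames\<close>

text \<open>Both sides are homogeneous of degree \<open>2\<close>, so the identity extends from unit vectors to
  all vectors by normalization.\<close>

lemma parseval_frame_identity:
  assumes pf: "parseval_frame m n v" and x: "x \<in> carrier_vec m"
  shows "(\<Sum>j<n. (cmod (x \<bullet>c v j))\<^sup>2) = (cvec_norm x)\<^sup>2"
proof (cases "cvec_norm x = 0")
  case True
  have "(\<Sum>i<m. (cmod (x $ i))\<^sup>2) = 0"
    using True x by (simp add: cvec_norm_def)
  hence "x = 0\<^sub>v m"
    using x by (intro eq_vecI) (auto simp: sum_nonneg_eq_0_iff)
  moreover have "0\<^sub>v m \<bullet>c v j = 0" if "j < n" for j
    using pf that by (auto simp: parseval_frame_def)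
  ultimately show ?thesis using True by simp
next
  case False
  define t where "t = 1 / cvec_norm x"
  have sq: "(cvec_norm y)\<^sup>2 = (\<Sum>i<dim_vec y. (cmod (y $ i))\<^sup>2)" for y
    by (simp add: cvec_norm_def sum_nonneg)
  have nn: "0 \<le> cvec_norm y" for y
    by (simp add: cvec_norm_def sum_nonneg)
  let ?y = "complex_of_real t \<cdot>\<^sub>v x"
  have "(cvec_norm ?y)\<^sup>2 = t\<^sup>2 * (cvec_norm x)\<^sup>2"
    by (simp add: sq norm_mult power_mult_distrib sum_distrib_left)
  hence "(cvec_norm ?y)\<^sup>2 = 1"
    using False by (simp add: t_def power_divide)
  hence "cvec_norm ?y = 1"
    using nn[of ?y] by (simp add: power2_eq_1_iff)
  hence "(\<Sum>j<n. (cmod (?y \<bullet>c v j))\<^sup>2) = 1"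
    using pf x by (auto simp: parseval_frame_def)
  moreover have "(cmod (?y \<bullet>c v j))\<^sup>2 = t\<^sup>2 * (cmod (x \<bullet>c v j))\<^sup>2" if "j < n" for j
  proof -
    have "v j \<in> carrier_vec m" using pf that by (simp add: parseval_frame_def)
    thus ?thesis using x by (simp add: norm_mult power_mult_distrib)
  qed
  ultimately have "t\<^sup>2 * (\<Sum>j<n. (cmod (x \<bullet>c v j))\<^sup>2) = 1"
    by (simp add: sum_distrib_left)
  thus ?thesis using False by (simp add: t_def power_divide field_simps)
qed

text \<open>Polarization: for \<open>a \<noteq> b\<close> and \<open>A = \<Sum>\<^sub>j v\<^sub>j(a) (v\<^sub>j(b))\<^sup>*\<close>, the Parseval identity at
  \<open>e\<^sub>a + c e\<^sub>b\<close>, once the rows are known to have norm \<open>1\<close> (the case \<open>x = e\<^sub>a\<close>), says that \<open>c A\<close> has real part \<open>0\<close> for every \<open>c\<close>; the choice \<open>c = A\<^sup>*\<close> gives \<open>A = 0\<close>.\<close>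

lemma parseval_frame_rows_orthonormal:
  assumes pf: "parseval_frame m n v" and a: "a < m" and b: "b < m"
  shows "(\<Sum>j<n. v j $ a * cnj (v j $ b)) = (if a = b then 1 else 0)"
proof -
  have vm: "v j \<in> carrier_vec m" if "j < n" for j
    using pf that by (simp add: parseval_frame_def)
  have sprod: "(unit_vec m p + c \<cdot>\<^sub>v unit_vec m q) \<bullet>c v j = cnj (v j $ p) + c * cnj (v j $ q)"
    if "p < m" "q < m" "j < n" for p q c j
    using vm[OF that(3)] that
    by (simp add: add_scalar_prod_distrib[of _ m] scalar_prod_left_unit)
  have one: "(\<Sum>j<n. (cmod (v j $ p))\<^sup>2) = 1" if p: "p < m" for p
  proof -
    have "(\<Sum>j<n. (cmod (unit_vec m p \<bullet>c v j))\<^sup>2) = (cvec_norm (unit_vec m p))\<^sup>2"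
      by (rule parseval_frame_identity[OF pf]) simp
    moreover have "cmod (unit_vec m p \<bullet>c v j) = cmod (v j $ p)" if "j < n" for j
      using vm[OF that] p by (simp add: scalar_prod_left_unit)
    moreover have "(cvec_norm (unit_vec m p))\<^sup>2 = 1"
    proof -
      have "(\<Sum>i<m. (cmod (unit_vec m p $ i))\<^sup>2) = (\<Sum>i<m. if i = p then 1 else 0)"
        using p by (intro sum.cong) auto
      thus ?thesis using p by (simp add: cvec_norm_def)
    qed
    ultimately show ?thesis by simp
  qed
  show ?thesis
  proof (cases "a = b")
    case True
    have "(\<Sum>j<n. v j $ a * cnj (v j $ a)) = complex_of_real (\<Sum>j<n. (cmod (v j $ a))\<^sup>2)"
      by (simp add: complex_norm_square del: of_real_power)
    with True one[OF a] show ?thesis by simp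
  next
    case False
    define A where "A = (\<Sum>j<n. v j $ a * cnj (v j $ b))"
    define c where "c = cnj A"
    let ?x = "unit_vec m a + c \<cdot>\<^sub>v unit_vec m b"
    have "(cvec_norm ?x)\<^sup>2 = (\<Sum>i<m. (cmod (?x $ i))\<^sup>2)"
      by (simp add: cvec_norm_def sum_nonneg)
    also have "\<dots> = (\<Sum>i<m. (if i = a then 1 else 0) + (if i = b then (cmod c)\<^sup>2 else 0))"
      using False a b by (intro sum.cong) auto
    also have "\<dots> = 1 + (cmod c)\<^sup>2"
      using a b by (simp add: sum.distrib)
    finally have norm_x: "(cvec_norm ?x)\<^sup>2 = 1 + (cmod c)\<^sup>2" .
    have expand: "(cmod (?x \<bullet>c v j))\<^sup>2 = (cmod (v j $ a))\<^sup>2 + (cmod c)\<^sup>2 * (cmod (v j $ b))\<^sup>2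
        + 2 * Re (c * (v j $ a * cnj (v j $ b)))" if "j < n" for j
      unfolding sprod[OF a b that] cmod_power2 by (simp add: algebra_simps power2_eq_square)
    have "(cvec_norm ?x)\<^sup>2 = (\<Sum>j<n. (cmod (?x \<bullet>c v j))\<^sup>2)"
      by (rule parseval_frame_identity[OF pf, symmetric]) simp
    also have "\<dots> = (\<Sum>j<n. (cmod (v j $ a))\<^sup>2) + (cmod c)\<^sup>2 * (\<Sum>j<n. (cmod (v j $ b))\<^sup>2)
        + 2 * Re (c * A)"
      by (simp add: expand sum.distrib sum_distrib_left A_def Re_sum del: times_complex.sel)
    finally have "Re (c * A) = 0"
      using norm_x one[OF a] one[OF b] by simp
    hence "(cmod A)\<^sup>2 = 0"
      unfolding c_def cmod_power2 by (simp add: power2_eq_square)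
    thus ?thesis using False by (simp add: A_def)
  qed
qed

text \<open>The rows of the synthesis matrix of the frame, completed to an orthonormal family, are
  the rows of a unitary dilation.\<close>

lemma parseval_frame_unitary_dilation:
  assumes mn: "m \<le> n" and pf: "parseval_frame m n v"
  shows "\<exists>G s. unitary_mat n G \<and> (\<forall>j<n. s j \<in> carrier_vec (n - m) \<and> col G j = v j @\<^sub>v s j)"
proof -
  define w where "w = (\<lambda>i. vec n (\<lambda>j. v j $ i))"
  have "w i \<in> carrier_vec n" for i
    by (simp add: w_def)
  moreover have "w i \<bullet>c w k = (if i = k then 1 else 0)" if "i < m" "k < m" for i k
    using parseval_frame_rows_orthonormal[OF pf that]
    by (simp add: w_def scalar_prod_def lessThan_atLeast0)
  ultimately obtain w' where
    ww: "\<And>i. i < m \<Longrightarrow> w' i = w i" and wc: "\<And>i. i < n \<Longrightarrow> w' i \<in> carrier_vec n"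
    and wo: "\<And>i k. i < n \<Longrightarrow> k < n \<Longrightarrow> w' i \<bullet>c w' k = (if i = k then 1 else 0)"
    using orthonormal_extend[OF mn, of w] by blast
  define G where "G = mat n n (\<lambda>(i, j). w' i $ j)"
  define s where "s = (\<lambda>j. vec (n - m) (\<lambda>i. w' (m + i) $ j))"
  have G: "G \<in> carrier_mat n n" by (simp add: G_def)
  note G' = mat_adjoint_carrier[OF G]
  have "unitary_mat n G"
  proof (rule unitary_matI[OF G], rule eq_matI)
    fix i k assume "i < dim_row (1\<^sub>m n)" "k < dim_col (1\<^sub>m n)"
    hence ik: "i < n" "k < n" by auto
    have "(G * mat_adjoint G) $$ (i, k) = (\<Sum>j<n. w' i $ j * cnj (w' k $ j))"
      using G G' ik by (simp add: scalar_prod_def lessThan_atLeast0) (simp add: G_def)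
    also have "\<dots> = w' i \<bullet>c w' k"
      using wc[OF ik(1)] wc[OF ik(2)] by (simp add: scalar_prod_def lessThan_atLeast0)
    finally show "(G * mat_adjoint G) $$ (i, k) = 1\<^sub>m n $$ (i, k)"
      using ik by (simp add: wo)
  qed (use G G' in auto)
  moreover have "col G j = v j @\<^sub>v s j" if j: "j < n" for j
  proof (rule eq_vecI)
    have vj: "dim_vec (v j) = m" using pf j by (auto simp: parseval_frame_def)
    show "dim_vec (col G j) = dim_vec (v j @\<^sub>v s j)" using mn by (simp add: vj s_def G_def)
    fix i assume "i < dim_vec (v j @\<^sub>v s j)"
    hence i: "i < n" using mn by (simp add: vj s_def)
    show "col G j $ i = (v j @\<^sub>v s j) $ i"
    proof (cases "i < m")
      case True
      thus ?thesis using i j vj by (simp add: s_def G_def ww w_def)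
    next
      case False
      hence "m + (i - m) = i" by simp
      thus ?thesis using False i j vj by (simp add: s_def G_def)
    qed
  qed
  ultimately show ?thesis
    by (intro exI[of _ G] exI[of _ s]) (simp add: s_def)
qed

theorem mainTheorem4:
  fixes m n r :: nat
    and v :: "nat \<Rightarrow> complex vec"
    and F :: "complex mat"
  assumes "0 < m" and "m \<le> n" and "n = 2 ^ r" and "0 < r"
    and "parseval_frame m n v"
    and "\<forall>i<n. \<forall>j<n. cvec_norm (v i) = cvec_norm (v j)"
    and "F = complex_of_real (1 / sqrt (real n)) \<cdot>\<^sub>m walsh r"
  shows "\<exists>(s :: nat \<Rightarrow> complex vec) (P :: complex mat).
    (\<forall>j<n. s j \<in> carrier_vec (n - m)) \<and>
    unitary_mat n P \<and>
    (let g = (\<lambda>j. v j @\<^sub>v s j) in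
      orthonormal_basis n g \<and>
      (\<forall>j<n. P *\<^sub>v g j = col F j) \<and>
      (\<forall>x\<in>carrier_vec m.
        x @\<^sub>v 0\<^sub>v (n - m) =
          finsum_vec TYPE(complex) n (\<lambda>j. (x \<bullet>c v j) \<cdot>\<^sub>v g j) {..<n} \<and>
        P *\<^sub>v (x @\<^sub>v 0\<^sub>v (n - m)) =
          finsum_vec TYPE(complex) n (\<lambda>j. (x \<bullet>c v j) \<cdot>\<^sub>v col F j) {..<n}))"
proof -
  note mn = \<open>m \<le> n\<close> and pf = \<open>parseval_frame m n v\<close>
  obtain G s where U: "unitary_mat n G" and s: "\<And>j. j < n \<Longrightarrow> s j \<in> carrier_vec (n - m)"
    and colG: "\<And>j. j < n \<Longrightarrow> col G j = v j @\<^sub>v s j"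
    using parseval_frame_unitary_dilation[OF mn pf] by blast
  have G: "G \<in> carrier_mat n n" and GG: "mat_adjoint G * G = 1\<^sub>m n" "G * mat_adjoint G = 1\<^sub>m n"
    using U by (auto simp: unitary_mat_def)
  note G' = mat_adjoint_carrier[OF G]
  have UF: "unitary_mat n F"
    using normalized_walsh_unitary[of r] assms(3,7) by simp
  hence F: "F \<in> carrier_mat n n" by (simp add: unitary_mat_def)
  define P where "P = F * mat_adjoint G"
  have UP: "unitary_mat n P"
    unfolding P_def by (rule unitary_mat_mult[OF UF unitary_mat_adjoint[OF U]])
  hence P: "P \<in> carrier_mat n n" by (simp add: unitary_mat_def)
  have PG: "P * G = F"
    using F G G' by (simp add: P_def GG assoc_mult_mat[of _ n n _ n _ n])
  have "orthonormal_basis n (\<lambda>j. v j @\<^sub>v s j)"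
    using unitary_mat_cols_orthonormal_basis[OF U] colG
    by (simp add: orthonormal_basis_def image_def)
  moreover have "P *\<^sub>v (v j @\<^sub>v s j) = col F j" if "j < n" for j
    using that col_mult2[OF P G that] by (simp add: PG colG)
  moreover have "x @\<^sub>v 0\<^sub>v (n - m) =
        finsum_vec TYPE(complex) n (\<lambda>j. (x \<bullet>c v j) \<cdot>\<^sub>v (v j @\<^sub>v s j)) {..<n}"
      (is ?synth)
    and "P *\<^sub>v (x @\<^sub>v 0\<^sub>v (n - m)) =
        finsum_vec TYPE(complex) n (\<lambda>j. (x \<bullet>c v j) \<cdot>\<^sub>v col F j) {..<n}"
      (is ?image)
    if x: "x \<in> carrier_vec m" for x
  proof -
    let ?y = "x @\<^sub>v 0\<^sub>v (n - m)"
    let ?c = "vec n (\<lambda>j. x \<bullet>c v j)"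
    have y: "?y \<in> carrier_vec n"
      using append_carrier_vec[OF x zero_carrier_vec[of "n - m"]] mn by simp
    have coords: "mat_adjoint G *\<^sub>v ?y = ?c"
    proof (rule eq_vecI)
      fix j assume "j < dim_vec ?c"
      hence j: "j < n" by simp
      have vj: "v j \<in> carrier_vec m" using pf j by (simp add: parseval_frame_def)
      have "row (mat_adjoint G) j = conjugate (col G j)"
        using G G' j by (intro eq_vecI) auto
      also have "\<dots> = conjugate (v j) @\<^sub>v conjugate (s j)"
        using colG[OF j] by (intro eq_vecI) auto
      finally have "(mat_adjoint G *\<^sub>v ?y) $ j
          = (conjugate (v j) @\<^sub>v conjugate (s j)) \<bullet> (x @\<^sub>v 0\<^sub>v (n - m))"
        using G G' j by simp
      also have "\<dots> = conjugate (v j) \<bullet> x"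
        using vj s[OF j] x by (subst scalar_prod_append[of _ m _ "n - m"]) auto
      also have "\<dots> = x \<bullet>c v j"
        using conjugate_vec_sprod_comm[OF x vj] by simp
      finally show "(mat_adjoint G *\<^sub>v ?y) $ j = ?c $ j" using j by simp
    qed (use G' in auto)
    have y_eq: "?y = G *\<^sub>v ?c"
      using assoc_mult_mat_vec[OF G G' y] y by (simp add: GG coords)
    also have "\<dots> = finsum_vec TYPE(complex) n (\<lambda>j. (x \<bullet>c v j) \<cdot>\<^sub>v col G j) {..<n}"
      by (rule mult_mat_vec_eq_finsum_cols[OF G])
    also have "\<dots> = finsum_vec TYPE(complex) n (\<lambda>j. (x \<bullet>c v j) \<cdot>\<^sub>v (v j @\<^sub>v s j)) {..<n}"
      unfolding finsum_vec_def
      by (rule comm_monoid.finprod_cong'[OF comm_monoid_vec])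
        (use G colG in \<open>auto simp: monoid_vec_simps simp flip: colG\<close>)
    finally show ?synth .
    have "P *\<^sub>v ?y = F *\<^sub>v ?c"
      using assoc_mult_mat_vec[OF P G, of ?c] by (simp add: PG y_eq)
    also have "\<dots> = finsum_vec TYPE(complex) n (\<lambda>j. (x \<bullet>c v j) \<cdot>\<^sub>v col F j) {..<n}"
      by (rule mult_mat_vec_eq_finsum_cols[OF F])
    finally show ?image .
  qed
  ultimately show ?thesis
    using s UP unfolding Let_def by (intro exI[of _ s] exI[of _ P]) blast
qed

end
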